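(* Let $f\in\mathcal F_{<\infty}(\mathbb R^n)$, $r>0$, and $x_0\in\mathbb R^n$. Let $(x,z)$ be the $C^1(\mathbb R_{\ge0})$ solution of $$\dot x(t)=\frac rt\,(z(t)-x(t)),\qquad \dot z(t)=-\frac tr\,\nabla f(x(t))\qquad(t>0),\qquad x(0)=z(0)=x_0,$$ and let $(X,Z)$ be the $C^1(\mathbb R_{\ge0})$ solution of $$\dot X(t)=\frac{r+2}{t}\,(\nabla f(Z(t))-X(t)),\qquad \dot Z(t)=-\frac{t}{r+2}\,X(t)\qquad(t>0),\qquad Z(0)=x_0,\ X(0)=\nabla f(x_0).$$ Then, for all $t>0$, $$x(t)=Z(t),\qquad z(t)=Z(t)-\frac{t^2}{r(r+2)}X(t).$$ Equivalently, for all $t>0$, $$X(t)=\frac{r(r+2)}{t^2}\,(x(t)-z(t)),\qquad Z(t)=x(t).$$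
   Context: $\mathcal F_{<\infty}(\mathbb R^n):=\bigcup_{L>0}\mathcal F_L(\mathbb R^n)$, where $\mathcal F_L(\mathbb R^n)$ is the set of finite-valued differentiable convex functions $f:\mathbb R^n\to\mathbb R$ whose gradient is $L$-Lipschitz (Euclidean norm). $\mathbb R_{\ge0}=[0,\infty)$. It is known that each of the two ODE systems has a unique solution in $C^1(\mathbb R_{\ge0})$ (derivative at $0$ being the right-hand derivative). The first system is the NAG ODE (continuous-time model of Nesterov's accelerated gradient method for minimizing $f$); the second is the accelerated mirror descent ODE with parameter $R=r+2$ for minimizing $\|p\|^2/2$ over $p\in\operatorname{dom} f^*$, with $f$ as the conjugate of the distance-generating function. *)

theory Defs
  imports "HOL-Analysis.Analysis"
begin

text \<open>The gradient at a point; only meaningful where the function is differentiable, and there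
  it is the unique vector satisfying the library predicate (see \<open>GDERIV_gradient\<close>).\<close>

definition gradient :: "('a::euclidean_space \<Rightarrow> real) \<Rightarrow> 'a \<Rightarrow> 'a" where
  "gradient f x = (THE D. GDERIV f x :> D)"

lemma GDERIV_unique:
  fixes f :: "'a::euclidean_space \<Rightarrow> real"
  assumes "GDERIV f x :> D" "GDERIV f x :> E"
  shows "D = E"
proof -
  have "(\<lambda>h. h \<bullet> D) = (\<lambda>h. h \<bullet> E)"
    using assms unfolding gderiv_def by (rule has_derivative_unique)
  then show ?thesis
    by (metis vector_eq_ldot)
qed

lemma GDERIV_gradient:
  fixes f :: "'a::euclidean_space \<Rightarrow> real"
  assumes "f differentiable (at x)"
  shows "GDERIV f x :> gradient f x"
proof -
  from assms obtain f' where f': "(f has_derivative f') (at x)"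
    unfolding differentiable_def by blast
  then have lin: "linear f'"
    by (rule has_derivative_linear)
  have "f' = (\<lambda>h. h \<bullet> adjoint f' 1)"
    using adjoint_works[OF lin, of _ 1] by (auto simp: fun_eq_iff)
  with f' have "GDERIV f x :> adjoint f' 1"
    unfolding gderiv_def by simp
  then show ?thesis
    unfolding gradient_def by (metis GDERIV_unique theI)
qed

definition smooth_convex :: "real \<Rightarrow> ('a::euclidean_space \<Rightarrow> real) set" where
  "smooth_convex L = {f. convex_on UNIV f \<and> (\<forall>x. f differentiable (at x)) \<and>
                          L-lipschitz_on UNIV (gradient f)}"

definition smooth_convex_fin :: "('a::euclidean_space \<Rightarrow> real) set" where
  "smooth_convex_fin = (\<Union>L\<in>{0<..}. smooth_convex L)"

text \<open>Continuous differentiability on \<open>[0, \<infinity>)\<close> with the right-hand derivative at \<open>0\<close>.  The library's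
  \<open>C1_differentiable_on\<close> is not used, as it asks for a two-sided derivative at \<open>0\<close>.\<close>

definition C1_nonneg :: "(real \<Rightarrow> 'a::real_normed_vector) \<Rightarrow> bool" where
  "C1_nonneg y \<longleftrightarrow>
     (\<exists>y'. (\<forall>t\<in>{0..}. (y has_vector_derivative y' t) (at t within {0..})) \<and>
           continuous_on {0..} y')"

text \<open>Curves are total functions on the reals; nothing is required of their values at
  negative times.\<close>

definition nag_ode_solution ::
  "real \<Rightarrow> ('a::euclidean_space \<Rightarrow> real) \<Rightarrow> 'a \<Rightarrow> (real \<Rightarrow> 'a) \<Rightarrow> (real \<Rightarrow> 'a) \<Rightarrow> bool" where
  "nag_ode_solution r f x0 x z \<longleftrightarrow>
     C1_nonneg x \<and> C1_nonneg z \<and>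
     (\<forall>t>0. (x has_vector_derivative (r / t) *\<^sub>R (z t - x t)) (at t) \<and>
            (z has_vector_derivative - (t / r) *\<^sub>R gradient f (x t)) (at t)) \<and>
     x 0 = x0 \<and> z 0 = x0"

text \<open>Accelerated mirror descent with parameter \<open>R\<close> for minimizing \<open>\<parallel>p\<parallel>\<^sup>2 / 2\<close>, whose gradient at
  \<open>X t\<close> is \<open>X t\<close>, with mirror map \<open>gradient f\<close>.\<close>

definition amd_ode_solution ::
  "real \<Rightarrow> ('a::euclidean_space \<Rightarrow> real) \<Rightarrow> 'a \<Rightarrow> (real \<Rightarrow> 'a) \<Rightarrow> (real \<Rightarrow> 'a) \<Rightarrow> bool" where
  "amd_ode_solution R f x0 X Z \<longleftrightarrow>
     C1_nonneg X \<and> C1_nonneg Z \<and>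
     (\<forall>t>0. (X has_vector_derivative (R / t) *\<^sub>R (gradient f (Z t) - X t)) (at t) \<and>
            (Z has_vector_derivative - (t / R) *\<^sub>R X t) (at t)) \<and>
     Z 0 = x0 \<and> X 0 = gradient f x0"

end

theory Submission
  imports Defs
begin

text \<open>A direct computation turns a solution \<open>(X, Z)\<close> of the mirror descent system into the solution
  \<open>(Z, Z - t\<^sup>2 X / (r (r + 2)))\<close> of the NAG system, so it suffices that the NAG system has at most
  one solution. For the differences \<open>a\<close>, \<open>b\<close> of the two components of two solutions, Gronwall's
  inequality on \<open>[0, T]\<close> applies to the energy \<open>\<parallel>a\<parallel>\<^sup>2 + r T \<parallel>b\<parallel>\<^sup>2 / t\<close>: the derivative of the
  weight \<open>1 / t\<close> contributes \<open>- r T \<parallel>b\<parallel>\<^sup>2 / t\<^sup>2\<close>, which absorbs the singular term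
  \<open>r \<parallel>b\<parallel>\<^sup>2 / t\<close>. The energy tends to \<open>0\<close> at \<open>t = 0\<close> because \<open>b\<close> vanishes there and is
  differentiable.\<close>

text \<open>The integrating factor \<open>exp (- K * s)\<close> turns the differential inequality
  into monotonicity of the product. Derivatives are required only on the open interval because the
  energy below is known to be differentiable only at positive times; at 0 continuity
  suffices.\<close>

lemma gronwall_nonpos:
  fixes u u' :: "real \<Rightarrow> real"
  assumes cont: "continuous_on {0..T} u"
    and init: "u 0 \<le> 0"
    and deriv: "\<And>t. 0 < t \<Longrightarrow> t < T \<Longrightarrow> (u has_real_derivative u' t) (at t)"
    and bound: "\<And>t. 0 < t \<Longrightarrow> t < T \<Longrightarrow> u' t \<le> K * u t"
    and t: "0 \<le> t" "t \<le> T"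
  shows "u t \<le> 0"
proof -
  let ?v = "\<lambda>s. exp (- K * s) * u s"
  have "?v t \<le> ?v 0"
  proof (rule DERIV_nonpos_imp_decreasing_open[where f = ?v])
    show "0 \<le> t" by fact
    show "\<exists>y. (?v has_real_derivative y) (at s) \<and> y \<le> 0" if "0 < s" "s < t" for s
    proof (intro exI conjI)
      show "(?v has_real_derivative exp (- K * s) * (u' s - K * u s)) (at s)"
        using that t by (auto intro!: derivative_eq_intros deriv simp: algebra_simps)
      show "exp (- K * s) * (u' s - K * u s) \<le> 0"
        using bound[of s] that t by (simp add: mult_nonneg_nonpos)
    qed
    show "continuous_on {0..t} ?v"
      using t by (intro continuous_intros continuous_on_subset[OF cont]) auto
  qed
  with init have "exp (- K * t) * u t \<le> 0"
    by simp
  then show ?thesis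
    by (simp add: mult_le_0_iff)
qed

lemma C1_nonneg_diff:
  assumes "C1_nonneg y" "C1_nonneg w"
  shows "C1_nonneg (\<lambda>t. y t - w t)"
proof -
  obtain y' w' where
    "\<forall>t\<in>{0..}. (y has_vector_derivative y' t) (at t within {0..})" "continuous_on {0..} y'"
    "\<forall>t\<in>{0..}. (w has_vector_derivative w' t) (at t within {0..})" "continuous_on {0..} w'"
    using assms unfolding C1_nonneg_def by blast
  then show ?thesis
    unfolding C1_nonneg_def
    by (intro exI[of _ "\<lambda>t. y' t - w' t"]) (auto intro!: has_vector_derivative_diff continuous_intros)
qed

lemma C1_nonneg_imp_continuous_on:
  assumes "C1_nonneg y"
  shows "continuous_on {0..} y"
  using assms unfolding C1_nonneg_def
  by (meson continuous_on_eq_continuous_within has_vector_derivative_continuous)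

text \<open>With \<open>k = r * (r + 2)\<close> this is the term subtracted from \<open>Z\<close> in
  the transformed NAG solution.\<close>

lemma C1_nonneg_quadratic_scaleR:
  assumes "C1_nonneg y"
  shows "C1_nonneg (\<lambda>t. (t\<^sup>2 / k) *\<^sub>R y t)"
proof -
  obtain y' where y':
    "\<forall>t\<in>{0..}. (y has_vector_derivative y' t) (at t within {0..})" "continuous_on {0..} y'"
    using assms unfolding C1_nonneg_def by blast
  show ?thesis
    unfolding C1_nonneg_def
  proof (intro exI[of _ "\<lambda>t. (t\<^sup>2 / k) *\<^sub>R y' t + (2 * t / k) *\<^sub>R y t"] conjI ballI)
    fix t :: real assume "t \<in> {0..}"
    moreover have "((\<lambda>t. t\<^sup>2 / k) has_real_derivative 2 * t / k) (at t within {0..})"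
      \<comment> \<open>For \<open>k = 0\<close> division by zero makes both the coefficient and its
        claimed derivative 0.\<close>
      by (cases "k = 0") (auto intro!: derivative_eq_intros)
    ultimately show "((\<lambda>t. (t\<^sup>2 / k) *\<^sub>R y t) has_vector_derivative
        (t\<^sup>2 / k) *\<^sub>R y' t + (2 * t / k) *\<^sub>R y t) (at t within {0..})"
      using y' by (auto intro!: has_vector_derivative_scaleR)
  next
    show "continuous_on {0..} (\<lambda>t. (t\<^sup>2 / k) *\<^sub>R y' t + (2 * t / k) *\<^sub>R y t)"
      using y'(2) C1_nonneg_imp_continuous_on[OF assms]
      by (cases "k = 0") (auto intro!: continuous_intros)
  qed
qed

text \<open>For t > 0 the quotient is \<open>norm (y t) * norm (y t /\<^sub>R t)\<close>: the first
  factor tends to 0 and the second to the norm of the right-hand derivative at 0.\<close>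

lemma C1_nonneg_norm_power2_over_tendsto_0:
  assumes "C1_nonneg y" "y 0 = 0"
  shows "((\<lambda>t. (norm (y t))\<^sup>2 / t) \<longlongrightarrow> 0) (at 0 within {0..})"
proof -
  obtain d where d: "(y has_vector_derivative d) (at 0 within {0..})"
    using assms unfolding C1_nonneg_def by force
  have "((\<lambda>t. y t /\<^sub>R t) \<longlongrightarrow> d) (at 0 within {0..})"
  proof (rule LIM_zero_cancel, rule Lim_transform_eventually)
    show "((\<lambda>t. (1 / norm (t - 0)) *\<^sub>R (y t - (y 0 + (t - 0) *\<^sub>R d))) \<longlongrightarrow> 0) (at 0 within {0..})"
      using d unfolding has_vector_derivative_def has_derivative_within by blast
    show "\<forall>\<^sub>F t in at 0 within {0..}.
        (1 / norm (t - 0)) *\<^sub>R (y t - (y 0 + (t - 0) *\<^sub>R d)) = y t /\<^sub>R t - d"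
      using assms(2) by (auto simp: eventually_at_filter scaleR_diff_right divide_inverse)
  qed
  moreover have "(y \<longlongrightarrow> 0) (at 0 within {0..})"
    using has_vector_derivative_continuous[OF d] assms(2) by (simp add: continuous_within)
  ultimately have "((\<lambda>t. norm (y t) * norm (y t /\<^sub>R t)) \<longlongrightarrow> norm (0::'a) * norm d) (at 0 within {0..})"
    by (intro tendsto_intros)
  then have lim: "((\<lambda>t. norm (y t) * norm (y t /\<^sub>R t)) \<longlongrightarrow> 0) (at 0 within {0..})"
    by simp
  have "\<forall>\<^sub>F t in at 0 within {0..}. norm (y t) * norm (y t /\<^sub>R t) = (norm (y t))\<^sup>2 / t"
    by (auto simp: eventually_at_filter power2_eq_square divide_inverse)
  with lim show ?thesis
    by (rule Lim_transform_eventually)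
qed

text \<open>A pointwise estimate in which \<open>a\<close>, \<open>b\<close> are values of the two
  differences and \<open>b'\<close> is the derivative of the second. The factor \<open>t\<close> in
  the bound on \<open>b'\<close> cancels the weight 1 / t, so the cross term is not
  singular.\<close>

lemma nag_energy_derivative_le:
  fixes a b b' :: "'a::real_inner"
  assumes "0 < r" "0 < t" "t \<le> T" "0 \<le> L"
    and b': "norm b' \<le> t / r * (L * norm a)"
  shows "2 * (a \<bullet> ((r / t) *\<^sub>R (b - a))) + r * T * (2 * (b \<bullet> b') / t - (norm b)\<^sup>2 / t\<^sup>2)
    \<le> T * L * (1 + 1 / r) * ((norm a)\<^sup>2 + r * T * ((norm b)\<^sup>2 / t))"
proof -
  have T: "0 < T" using assms by simp
  have ab: "2 * (norm a * norm b) \<le> (norm a)\<^sup>2 + (norm b)\<^sup>2"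
    using sum_squares_bound[of "norm a" "norm b"] by (simp add: mult.assoc)
  have "2 * (a \<bullet> ((r / t) *\<^sub>R (b - a))) = (r / t) * (2 * (a \<bullet> b) - 2 * (norm a)\<^sup>2)"
    by (simp add: inner_diff_right dot_square_norm algebra_simps)
  \<comment> \<open>By Cauchy-Schwarz and \<open>ab\<close>, the bracket is at most
    \<open>(norm b)\<^sup>2 - (norm a)\<^sup>2\<close>.\<close>
  also have "\<dots> \<le> (r / t) * (norm b)\<^sup>2"
    using ab norm_cauchy_schwarz[of a b] zero_le_power2[of "norm a"] assms
    by (intro mult_left_mono divide_nonneg_pos) linarith+
  \<comment> \<open>Here \<open>t \<le> T\<close> enters; the factor \<open>T\<close> in the energy
    is chosen for this comparison.\<close>
  also have "\<dots> \<le> r * T * (norm b)\<^sup>2 / t\<^sup>2"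
    using assms by (simp add: field_simps power2_eq_square mult_right_mono)
  finally have A: "2 * (a \<bullet> ((r / t) *\<^sub>R (b - a))) \<le> r * T * (norm b)\<^sup>2 / t\<^sup>2" .
  have "b \<bullet> b' \<le> norm b * (t / r * (L * norm a))"
    by (meson b' mult_left_mono norm_cauchy_schwarz norm_ge_zero order_trans)
  then have "r * T * (2 * (b \<bullet> b') / t) \<le> r * T * (2 * (norm b * (t / r * (L * norm a))) / t)"
    using assms T by (intro mult_left_mono divide_right_mono) auto
  also have "\<dots> = T * L * (2 * (norm a * norm b))"
    using assms by simp
  also have "\<dots> \<le> T * L * ((norm a)\<^sup>2 + (norm b)\<^sup>2)"
    using ab assms T by (intro mult_left_mono) auto
  \<comment> \<open>The summand 1 / r of the constant pays for \<open>(norm b)\<^sup>2\<close>,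
    which is at most \<open>(norm b)\<^sup>2 * (T / t)\<close>, that is, 1 / r times the second
    energy term.\<close>
  also have "\<dots> \<le> T * L * ((1 + 1 / r) * ((norm a)\<^sup>2 + r * T * ((norm b)\<^sup>2 / t)))"
  proof (intro mult_left_mono)
    have "(norm b)\<^sup>2 * 1 \<le> (norm b)\<^sup>2 * (T / t)"
      using assms by (intro mult_left_mono) auto
    moreover have "0 \<le> (norm a)\<^sup>2 / r" "0 \<le> r * T * ((norm b)\<^sup>2 / t)"
      using assms T by auto
    moreover have "(1 + 1 / r) * ((norm a)\<^sup>2 + r * T * ((norm b)\<^sup>2 / t)) =
        (norm a)\<^sup>2 + (norm a)\<^sup>2 / r + r * T * ((norm b)\<^sup>2 / t) + (norm b)\<^sup>2 * (T / t)"
      using assms by (simp add: field_simps)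
    ultimately show "(norm a)\<^sup>2 + (norm b)\<^sup>2 \<le> (1 + 1 / r) * ((norm a)\<^sup>2 + r * T * ((norm b)\<^sup>2 / t))"
      by linarith
  qed (use assms T in auto)
  finally show ?thesis
    using A by (simp add: right_diff_distrib mult.assoc)
qed

lemma nag_ode_solution_unique:
  fixes f :: "'a::euclidean_space \<Rightarrow> real"
  assumes lip: "L-lipschitz_on UNIV (gradient f)"
    and r: "0 < r"
    and sol1: "nag_ode_solution r f x0 x z"
    and sol2: "nag_ode_solution r f x0 y w"
    and T: "0 < T"
  shows "x T = y T" "z T = w T"
proof -
  define a where "a t = x t - y t" for t
  define b where "b t = z t - w t" for t
  define b' where "b' t = - (t / r) *\<^sub>R (gradient f (x t) - gradient f (y t))" for t
  define E where "E t = (norm (a t))\<^sup>2 + r * T * ((norm (b t))\<^sup>2 / t)" for t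
  define E' where "E' t = 2 * (a t \<bullet> ((r / t) *\<^sub>R (b t - a t))) +
    r * T * (2 * (b t \<bullet> b' t) / t - (norm (b t))\<^sup>2 / t\<^sup>2)" for t
  have C1: "C1_nonneg a" "C1_nonneg b" and init: "a 0 = 0" "b 0 = 0"
    using sol1 sol2 unfolding nag_ode_solution_def a_def b_def by (auto intro: C1_nonneg_diff)
  have da: "(a has_vector_derivative (r / t) *\<^sub>R (b t - a t)) (at t)" if "0 < t" for t
  proof -
    have "(a has_vector_derivative (r / t) *\<^sub>R (z t - x t) - (r / t) *\<^sub>R (w t - y t)) (at t)"
      using sol1 sol2 that unfolding nag_ode_solution_def a_def
      by (intro has_vector_derivative_diff) auto
    then show ?thesis
      by (simp add: a_def b_def algebra_simps)
  qed
  have db: "(b has_vector_derivative b' t) (at t)" if "0 < t" for t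
  proof -
    have "(b has_vector_derivative - (t / r) *\<^sub>R gradient f (x t) - - (t / r) *\<^sub>R gradient f (y t)) (at t)"
      using sol1 sol2 that unfolding nag_ode_solution_def b_def
      by (intro has_vector_derivative_diff) auto
    then show ?thesis
      by (simp add: b'_def algebra_simps)
  qed
  have dE: "(E has_real_derivative E' t) (at t)" if t: "0 < t" for t
  proof -
    have norm_power2_deriv: "((\<lambda>s. (norm (g s))\<^sup>2) has_real_derivative 2 * (g t \<bullet> g')) (at t)"
      if "(g has_vector_derivative g') (at t)" for g :: "real \<Rightarrow> 'a" and g'
      using that unfolding has_vector_derivative_def has_field_derivative_def power2_norm_eq_inner
      by (auto intro!: derivative_eq_intros simp: fun_eq_iff inner_commute algebra_simps)
    have "(E has_real_derivative 2 * (a t \<bullet> ((r / t) *\<^sub>R (b t - a t))) +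
        r * T * ((2 * (b t \<bullet> b' t) * t - (norm (b t))\<^sup>2 * 1) / (t * t))) (at t)"
      unfolding E_def[abs_def] using t
      by (intro DERIV_add DERIV_cmult DERIV_divide DERIV_ident norm_power2_deriv da db) auto
    moreover have "(2 * (b t \<bullet> b' t) * t - (norm (b t))\<^sup>2 * 1) / (t * t) =
        2 * (b t \<bullet> b' t) / t - (norm (b t))\<^sup>2 / t\<^sup>2"
      using t by (simp add: diff_divide_distrib power2_eq_square)
    ultimately show ?thesis
      unfolding E'_def by (simp only:)
  qed
  have "norm (b' t) \<le> t / r * (L * norm (a t))" if "0 < t" for t
    using lipschitz_onD[OF lip, of "x t" "y t"] that r
    by (auto simp: b'_def a_def dist_norm intro!: divide_right_mono mult_left_mono)
  then have bound: "E' t \<le> T * L * (1 + 1 / r) * E t" if "0 < t" "t < T" for t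
    unfolding E_def E'_def using that r lipschitz_on_nonneg[OF lip]
    by (intro nag_energy_derivative_le) auto
  have "continuous_on {0..} E"
    unfolding continuous_on_eq_continuous_within
  proof
    fix t :: real assume "t \<in> {0..}"
    then consider "t = 0" | "0 < t" by force
    then show "continuous (at t within {0..}) E"
    proof cases
      case 1
      have "(a \<longlongrightarrow> 0) (at 0 within {0..})"
        using C1_nonneg_imp_continuous_on[OF C1(1)] init unfolding continuous_on_def by force
      then have "(E \<longlongrightarrow> (norm (0::'a))\<^sup>2 + r * T * 0) (at 0 within {0..})"
        unfolding E_def[abs_def]
        by (intro tendsto_intros C1_nonneg_norm_power2_over_tendsto_0 C1 init)
      \<comment> \<open>The limit is also the value: \<open>E 0 = 0\<close>, since division by zero
        gives 0.\<close>
      then show ?thesis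
        using 1 init by (simp add: continuous_within E_def)
    next
      case 2
      then show ?thesis
        using dE DERIV_isCont continuous_at_imp_continuous_at_within by blast
    qed
  qed
  then have cont: "continuous_on {0..T} E"
    by (rule continuous_on_subset) auto
  have "E 0 \<le> 0"
    using init by (simp add: E_def)
  \<comment> \<open>At the endpoint \<open>t = T\<close> the weight \<open>r * T / t\<close> is just
    \<open>r\<close>, so both differences vanish there; \<open>T\<close> was arbitrary.\<close>
  from gronwall_nonpos[OF cont this dE bound, of T]
  have "(norm (a T))\<^sup>2 + r * (norm (b T))\<^sup>2 \<le> 0"
    using T by (simp add: E_def)
  moreover have "0 \<le> (norm (a T))\<^sup>2" "0 \<le> r * (norm (b T))\<^sup>2"
    using r by auto
  ultimately have "(norm (a T))\<^sup>2 = 0" "r * (norm (b T))\<^sup>2 = 0"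
    by linarith+
  then show "x T = y T" "z T = w T"
    using r by (auto simp: a_def b_def)
qed

text \<open>With x = Z, the first NAG equation forces z = Z + (t / r) Z', and inserting the equation
  for Z' gives the stated second component. In its derivative the coefficient of X is t (R - r - 2)
  / (r R) for mirror descent parameter R, which vanishes exactly for R = r + 2.\<close>

lemma amd_ode_solution_imp_nag_ode_solution:
  fixes f :: "'a::euclidean_space \<Rightarrow> real"
  assumes r: "0 < r"
    and sol: "amd_ode_solution (r + 2) f x0 X Z"
  shows "nag_ode_solution r f x0 Z (\<lambda>t. Z t - (t\<^sup>2 / (r * (r + 2))) *\<^sub>R X t)"
  unfolding nag_ode_solution_def
proof (intro conjI allI impI)
  show "C1_nonneg Z" "C1_nonneg (\<lambda>t. Z t - (t\<^sup>2 / (r * (r + 2))) *\<^sub>R X t)"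
    using sol unfolding amd_ode_solution_def
    by (auto intro!: C1_nonneg_diff C1_nonneg_quadratic_scaleR)
  show "Z 0 = x0" "Z 0 - (0\<^sup>2 / (r * (r + 2))) *\<^sub>R X 0 = x0"
    using sol by (simp_all add: amd_ode_solution_def)
next
  fix t :: real assume t: "0 < t"
  have dX: "(X has_vector_derivative ((r + 2) / t) *\<^sub>R (gradient f (Z t) - X t)) (at t)"
    and dZ: "(Z has_vector_derivative - (t / (r + 2)) *\<^sub>R X t) (at t)"
    using sol t by (auto simp: amd_ode_solution_def)
  have "r / t * (t\<^sup>2 / (r * (r + 2))) = t / (r + 2)"
    using r t by (simp add: power2_eq_square)
  then show "(Z has_vector_derivative (r / t) *\<^sub>R (Z t - (t\<^sup>2 / (r * (r + 2))) *\<^sub>R X t - Z t)) (at t)"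
    using dZ by simp
  have dq: "((\<lambda>t. t\<^sup>2 / (r * (r + 2))) has_real_derivative 2 * t / (r * (r + 2))) (at t)"
    using r by (auto intro!: derivative_eq_intros)
  have coeff: "t\<^sup>2 / (r * (r + 2)) * ((r + 2) / t) = t / r"
    "- (t / (r + 2)) + t / r - 2 * t / (r * (r + 2)) = 0"
    using r t by (simp_all add: power2_eq_square divide_simps) (simp_all add: algebra_simps)
  \<comment> \<open>The left side is what the difference and product rules produce; the right side
    collects the gradient and \<open>X t\<close> terms.\<close>
  have "- (t / (r + 2)) *\<^sub>R X t - ((t\<^sup>2 / (r * (r + 2))) *\<^sub>R (((r + 2) / t) *\<^sub>R (gradient f (Z t) - X t)) +
      (2 * t / (r * (r + 2))) *\<^sub>R X t)
    = - (t / r) *\<^sub>R gradient f (Z t) + (- (t / (r + 2)) + t / r - 2 * t / (r * (r + 2))) *\<^sub>R X t"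
    unfolding scaleR_scaleR coeff(1)
    by (simp only: scaleR_diff_right scaleR_diff_left scaleR_add_left scaleR_minus_left) simp
  also have "\<dots> = - (t / r) *\<^sub>R gradient f (Z t)"
    unfolding coeff(2) by simp
  finally show "((\<lambda>t. Z t - (t\<^sup>2 / (r * (r + 2))) *\<^sub>R X t) has_vector_derivative
      - (t / r) *\<^sub>R gradient f (Z t)) (at t)"
    using has_vector_derivative_diff[OF dZ has_vector_derivative_scaleR[OF dq dX]] by metis
qed

theorem theorem4p2:
  fixes f :: "real ^ 'n \<Rightarrow> real" and r :: real and x0 :: "real ^ 'n"
    and x z X Z :: "real \<Rightarrow> real ^ 'n"
  assumes "f \<in> smooth_convex_fin"
    and "r > 0"
    and "nag_ode_solution r f x0 x z"
    and "amd_ode_solution (r + 2) f x0 X Z"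
  shows "(\<forall>t>0. x t = Z t \<and> z t = Z t - (t\<^sup>2 / (r * (r + 2))) *\<^sub>R X t) \<and>
         (\<forall>t>0. X t = (r * (r + 2) / t\<^sup>2) *\<^sub>R (x t - z t) \<and> Z t = x t)"
proof -
  obtain L where "L-lipschitz_on UNIV (gradient f)"
    using assms(1) by (auto simp: smooth_convex_fin_def smooth_convex_def)
  note unique = nag_ode_solution_unique[OF this assms(2,3)
    amd_ode_solution_imp_nag_ode_solution[OF assms(2,4)]]
  \<comment> \<open>The formula for \<open>z t\<close> is solved for \<open>X t\<close>, whose
    coefficient is nonzero for t > 0.\<close>
  have "X t = (r * (r + 2) / t\<^sup>2) *\<^sub>R (x t - z t)" if "0 < t" for t
    using unique[OF that] that assms(2) by simp
  with unique show ?thesis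
    by auto
qed

end
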